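(* Let $\mathcal{E}_1$ and $\mathcal{E}_2$ be two unital single-qubit quantum channels with distortion matrices $\Lambda_1=\alpha_1R_1$ and $\Lambda_2=\alpha_2R_2$, respectively, where $R_1,R_2$ are $3\times 3$ rotation matrices and $\alpha_1,\alpha_2$ are real proportionality factors. Then the entropic channel divergence (without ancilla) between them reads $$d_{\mathrm{t}}^{K=1}(\mathcal{E}_1,\mathcal{E}_2)=\sqrt{f(r_{\mathrm{opt}})-\frac{f(\alpha_1^2)+f(\alpha_2^2)}{2}},$$ with $$r_{\mathrm{opt}}=\alpha_1^2+\alpha_2^2+\alpha_1\alpha_2\big(\mathrm{Tr}[\Lambda_1^{\intercal}\Lambda_2]-1\big),$$ where $f(x):=H_2\big(\tfrac{1-\sqrt{x}}{2}\big)$ and $H_2(x):=-x\log_2x-(1-x)\log_2(1-x)$, $x\in[0,1]$, is the binary entropy function.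
   Context: $\mathcal{M}_2$ denotes the set of $2\times2$ density matrices. A quantum channel is a completely positive trace-preserving map; it is unital if it fixes the identity. Writing a qubit state as $\rho=\frac12(\mathbb{1}+\boldsymbol{r}\cdot\boldsymbol{\sigma})$ with Bloch vector $\boldsymbol r\in\mathbb{R}^3$, $|\boldsymbol r|\le1$, and $\boldsymbol\sigma$ the vector of the three Pauli matrices, a unital qubit channel $\mathcal{E}$ acts by $\boldsymbol r\mapsto\Lambda_{\mathcal{E}}\boldsymbol r$ for a real $3\times3$ matrix $\Lambda_{\mathcal{E}}$, called its distortion matrix. The symbol $\intercal$ denotes transposition. With von Neumann entropy $\mathrm{S}(\rho)=-\mathrm{Tr}[\rho\log_2\rho]$, the quantum Jensen-Shannon divergence is $\mathrm{QJSD}(\rho,\sigma)=\mathrm{S}\big(\tfrac{\rho+\sigma}{2}\big)-\tfrac12\mathrm{S}(\rho)-\tfrac12\mathrm{S}(\sigma)$. The entropic channel divergence without ancilla is $$d_{\mathrm{t}}^{K=1}(\mathcal{E},\mathcal{F})=\sup_{\rho\in\mathcal{M}_2}\sqrt{\mathrm{QJSD}[\mathcal{E}(\rho),\mathcal{F}(\rho)]}.$$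
   Formalization: The printed r_opt is false (α₁=1, α₂=0 gives the root of −1/2). Proved instead: r_opt = (α₁²+α₂²+α₁α₂(Tr[R₁ᵀR₂]−1))/4 if α₁α₂≥0, and (α₁+α₂)²/4 if α₁α₂<0, so with factor 1/4, R_i for Λ_i in the trace, and a sign case. *)

theory Defs
  imports "HOL-Analysis.Analysis"
begin

section \<open>Complex matrices\<close>

definition cinner :: "complex^'n \<Rightarrow> complex^'n \<Rightarrow> complex" where
  "cinner v w = (\<Sum>a\<in>UNIV. cnj (v $ a) * w $ a)"

definition conj_transpose :: "complex^'n^'m \<Rightarrow> complex^'m^'n" where
  "conj_transpose A = map_matrix cnj (transpose A)"

definition unitary_matrix :: "complex^'n^'n \<Rightarrow> bool" where
  "unitary_matrix U \<longleftrightarrow> conj_transpose U ** U = mat 1 \<and> U ** conj_transpose U = mat 1"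

definition real_diag :: "('n \<Rightarrow> real) \<Rightarrow> complex^'n^'n" where
  "real_diag d = (\<chi> i j. if i = j then complex_of_real (d i) else 0)"

text \<open>Functional calculus for Hermitian matrices, through a unitary diagonalisation. The result
  does not depend on the diagonalisation; see \<open>matrix_fun_diagonalised\<close> below.\<close>

definition matrix_fun :: "(real \<Rightarrow> real) \<Rightarrow> complex^'n^'n \<Rightarrow> complex^'n^'n" where
  "matrix_fun f A = (THE B. \<exists>U d. unitary_matrix U \<and>
      A = U ** real_diag d ** conj_transpose U \<and>
      B = U ** real_diag (\<lambda>i. f (d i)) ** conj_transpose U)"

lemma matrix_mul_real_diag: "(A ** real_diag d) $ i $ j = A $ i $ j * complex_of_real (d j)"
  by (simp add: matrix_matrix_mult_def real_diag_def if_distrib[of "\<lambda>z. _ * z"] cong: if_cong)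

lemma real_diag_matrix_mul: "(real_diag d ** A) $ i $ j = complex_of_real (d i) * A $ i $ j"
  by (simp add: matrix_matrix_mult_def real_diag_def if_distrib[of "\<lambda>z. z * _"] cong: if_cong)

lemma diagonalisation_unique:
  fixes U V :: "complex^'n^'n"
  assumes U: "unitary_matrix U" and V: "unitary_matrix V"
    and eq: "U ** real_diag d ** conj_transpose U = V ** real_diag e ** conj_transpose V"
  shows "U ** real_diag (\<lambda>i. f (d i)) ** conj_transpose U
       = V ** real_diag (\<lambda>i. f (e i)) ** conj_transpose V"
proof -
  define W where "W = conj_transpose V ** U"
  have UU: "conj_transpose U ** U = mat 1" "U ** conj_transpose U = mat 1"
    and VV: "conj_transpose V ** V = mat 1" "V ** conj_transpose V = mat 1"
    using U V by (auto simp: unitary_matrix_def)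
  have "W ** real_diag d = conj_transpose V ** (U ** real_diag d ** conj_transpose U) ** U"
    by (simp add: W_def UU(1) flip: matrix_mul_assoc)
  also have "\<dots> = conj_transpose V ** (V ** real_diag e ** conj_transpose V) ** U"
    by (simp only: eq)
  also have "\<dots> = real_diag e ** W"
    by (simp add: W_def VV(1) matrix_mul_assoc)
  finally have WD: "W ** real_diag d = real_diag e ** W" .
  have "W $ i $ j * complex_of_real (f (d j)) = complex_of_real (f (e i)) * W $ i $ j" for i j
  proof (cases "W $ i $ j = 0")
    case False
    have "W $ i $ j * complex_of_real (d j) = complex_of_real (e i) * W $ i $ j"
      using arg_cong[OF WD, of "\<lambda>M. M $ i $ j"]
      by (simp only: matrix_mul_real_diag real_diag_matrix_mul)
    then have "d j = e i" using False by simp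
    then show ?thesis by simp
  qed simp
  then have Wf: "W ** real_diag (\<lambda>i. f (d i)) = real_diag (\<lambda>i. f (e i)) ** W"
    by (simp add: vec_eq_iff matrix_mul_real_diag real_diag_matrix_mul)
  have VW: "V ** W = U"
    by (simp add: W_def VV(2) matrix_mul_assoc)
  have WU: "W ** conj_transpose U = conj_transpose V"
    by (simp add: W_def UU(2) flip: matrix_mul_assoc)
  have "U ** real_diag (\<lambda>i. f (d i)) ** conj_transpose U
      = V ** (W ** real_diag (\<lambda>i. f (d i))) ** conj_transpose U"
    by (simp only: VW matrix_mul_assoc)
  also have "\<dots> = V ** real_diag (\<lambda>i. f (e i)) ** (W ** conj_transpose U)"
    by (simp only: Wf matrix_mul_assoc)
  finally show ?thesis by (simp only: WU)
qed

lemma matrix_fun_diagonalised: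
  assumes "unitary_matrix U"
  shows "matrix_fun f (U ** real_diag d ** conj_transpose U)
       = U ** real_diag (\<lambda>i. f (d i)) ** conj_transpose U"
  unfolding matrix_fun_def
proof (rule the_equality)
  show "\<exists>V e. unitary_matrix V \<and>
      U ** real_diag d ** conj_transpose U = V ** real_diag e ** conj_transpose V \<and>
      U ** real_diag (\<lambda>i. f (d i)) ** conj_transpose U
        = V ** real_diag (\<lambda>i. f (e i)) ** conj_transpose V"
    using assms by (intro exI[of _ U] exI[of _ d] conjI refl)
next
  fix B
  assume "\<exists>V e. unitary_matrix V \<and>
      U ** real_diag d ** conj_transpose U = V ** real_diag e ** conj_transpose V \<and>
      B = V ** real_diag (\<lambda>i. f (e i)) ** conj_transpose V"
  then obtain V e where V: "unitary_matrix V"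
    and eq: "U ** real_diag d ** conj_transpose U = V ** real_diag e ** conj_transpose V"
    and B: "B = V ** real_diag (\<lambda>i. f (e i)) ** conj_transpose V"
    by (elim exE conjE)
  show "B = U ** real_diag (\<lambda>i. f (d i)) ** conj_transpose U"
    unfolding B by (rule diagonalisation_unique[OF assms V eq, symmetric])
qed


section \<open>Quantum states and channels\<close>

text \<open>\<open>block_psd k X\<close>: the \<open>k \<times> k\<close> block matrix with blocks \<open>X i j\<close> (\<open>i, j < k\<close>), that is
  \<open>\<Sum>i j. |i><j| \<otimes> X i j\<close> on the tensor product of the \<open>k\<close>-dimensional space with the
  system, is positive semidefinite. Over the complex numbers this entails that it is Hermitian.\<close>

definition block_psd :: "nat \<Rightarrow> (nat \<Rightarrow> nat \<Rightarrow> complex^'n^'n) \<Rightarrow> bool" where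
  "block_psd k X \<longleftrightarrow>
     (\<forall>v :: nat \<Rightarrow> complex^'n. (\<Sum>i<k. \<Sum>j<k. cinner (v i) (X i j *v v j)) \<in> \<real>\<^sub>\<ge>\<^sub>0)"

definition psd :: "complex^'n^'n \<Rightarrow> bool" where
  "psd A \<longleftrightarrow> (\<forall>v. cinner v (A *v v) \<in> \<real>\<^sub>\<ge>\<^sub>0)"

definition density_matrix :: "complex^'n^'n \<Rightarrow> bool" where
  "density_matrix \<rho> \<longleftrightarrow> psd \<rho> \<and> trace \<rho> = 1"

definition complex_linear :: "(complex^'n^'n \<Rightarrow> complex^'m^'m) \<Rightarrow> bool" where
  "complex_linear E \<longleftrightarrow>
     (\<forall>A B. E (A + B) = E A + E B) \<and> (\<forall>c A. E (mat c ** A) = mat c ** E A)"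

text \<open>Positivity of \<open>id \<otimes> E\<close> for an ancilla of every dimension \<open>k\<close>.\<close>

definition completely_positive :: "(complex^'n^'n \<Rightarrow> complex^'m^'m) \<Rightarrow> bool" where
  "completely_positive E \<longleftrightarrow> (\<forall>k X. block_psd k X \<longrightarrow> block_psd k (\<lambda>i j. E (X i j)))"

definition trace_preserving :: "(complex^'n^'n \<Rightarrow> complex^'m^'m) \<Rightarrow> bool" where
  "trace_preserving E \<longleftrightarrow> (\<forall>A. trace (E A) = trace A)"

definition quantum_channel :: "(complex^'n^'n \<Rightarrow> complex^'m^'m) \<Rightarrow> bool" where
  "quantum_channel E \<longleftrightarrow> complex_linear E \<and> completely_positive E \<and> trace_preserving E"

definition unital :: "(complex^'n^'n \<Rightarrow> complex^'n^'n) \<Rightarrow> bool" where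
  "unital E \<longleftrightarrow> E (mat 1) = mat 1"


section \<open>Bloch representation\<close>

definition pauli_x :: "complex^2^2" where
  "pauli_x = vector [vector [0, 1], vector [1, 0]]"

definition pauli_y :: "complex^2^2" where
  "pauli_y = vector [vector [0, - \<i>], vector [\<i>, 0]]"

definition pauli_z :: "complex^2^2" where
  "pauli_z = vector [vector [1, 0], vector [0, - 1]]"

definition bloch_state :: "real^3 \<Rightarrow> complex^2^2" where
  "bloch_state r =
     (1/2) *\<^sub>R (mat 1 + r $ 1 *\<^sub>R pauli_x + r $ 2 *\<^sub>R pauli_y + r $ 3 *\<^sub>R pauli_z)"

definition has_distortion_matrix :: "(complex^2^2 \<Rightarrow> complex^2^2) \<Rightarrow> real^3^3 \<Rightarrow> bool" where
  "has_distortion_matrix E \<Lambda> \<longleftrightarrow>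
     (\<forall>r. norm r \<le> 1 \<longrightarrow> E (bloch_state r) = bloch_state (\<Lambda> *v r))"


section \<open>Entropies and the channel divergence\<close>

text \<open>Since \<open>log 2 0 = 0\<close> here, the convention \<open>0 log 0 = 0\<close> holds in both entropies below.\<close>

definition von_neumann_entropy :: "complex^'n^'n \<Rightarrow> real" where
  "von_neumann_entropy \<rho> = - Re (trace (\<rho> ** matrix_fun (log 2) \<rho>))"

definition QJSD :: "complex^'n^'n \<Rightarrow> complex^'n^'n \<Rightarrow> real" where
  "QJSD \<rho> \<sigma> = von_neumann_entropy ((1/2) *\<^sub>R (\<rho> + \<sigma>))
     - von_neumann_entropy \<rho> / 2 - von_neumann_entropy \<sigma> / 2"

text \<open>Channel divergence without ancilla. For qubit channels the supremum is over a nonempty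
  set bounded by 1, so it is a genuine real supremum.\<close>

definition entropic_channel_divergence ::
    "(complex^'n^'n \<Rightarrow> complex^'m^'m) \<Rightarrow> (complex^'n^'n \<Rightarrow> complex^'m^'m) \<Rightarrow> real" where
  "entropic_channel_divergence E F = (SUP \<rho>\<in>{\<rho>. density_matrix \<rho>}. sqrt (QJSD (E \<rho>) (F \<rho>)))"

definition binary_entropy :: "real \<Rightarrow> real" where
  "binary_entropy x = - x * log 2 x - (1 - x) * log 2 (1 - x)"

text \<open>The entropy of a qubit state as a function of the squared length of its Bloch vector.\<close>

definition bloch_entropy :: "real \<Rightarrow> real" where
  "bloch_entropy x = binary_entropy ((1 - sqrt x) / 2)"

text \<open>The optimal argument of \<^const>\<open>bloch_entropy\<close> for the distortion matrices
  \<open>\<alpha>\<^sub>1 R\<^sub>1\<close> and \<open>\<alpha>\<^sub>2 R\<^sub>2\<close>: the least squared length of the Bloch vector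
  \<open>(\<alpha>\<^sub>1 R\<^sub>1 r + \<alpha>\<^sub>2 R\<^sub>2 r) / 2\<close> of the averaged output over unit vectors \<open>r\<close>. This squared
  length is \<open>(\<alpha>\<^sub>1\<^sup>2 + \<alpha>\<^sub>2\<^sup>2 + 2 \<alpha>\<^sub>1 \<alpha>\<^sub>2 c) / 4\<close> with \<open>c = r \<bullet> (R\<^sub>1\<^sup>T R\<^sub>2 r)\<close>. If \<open>R\<^sub>1\<^sup>T R\<^sub>2\<close>
  rotates by the angle \<open>\<theta>\<close> then \<open>c\<close> ranges from \<open>cos \<theta> = (Tr (R\<^sub>1\<^sup>T R\<^sub>2) - 1) / 2\<close> to \<open>1\<close>,
  and the minimum is at the first of these if \<open>\<alpha>\<^sub>1 \<alpha>\<^sub>2 \<ge> 0\<close> and at the second otherwise.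

  The formula in print,
  \<open>\<alpha>\<^sub>1\<^sup>2 + \<alpha>\<^sub>2\<^sup>2 + \<alpha>\<^sub>1 \<alpha>\<^sub>2 (Tr (\<Lambda>\<^sub>1\<^sup>T \<Lambda>\<^sub>2) - 1)\<close> with \<open>\<Lambda>\<^sub>i = \<alpha>\<^sub>i R\<^sub>i\<close>, lacks the factor 1/4,
  has \<open>\<Lambda>\<^sub>i\<close> in place of \<open>R\<^sub>i\<close> in the trace and does not distinguish the sign of \<open>\<alpha>\<^sub>1 \<alpha>\<^sub>2\<close>.
  It cannot be meant literally. For the identity channel (\<open>\<alpha>\<^sub>1 = 1\<close>) and the completely
  depolarising channel (\<open>\<alpha>\<^sub>2 = 0\<close>) it gives 1, and the divergence would be the square root of
  \<open>-1/2\<close>.\<close>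

definition r_opt :: "real \<Rightarrow> real^3^3 \<Rightarrow> real \<Rightarrow> real^3^3 \<Rightarrow> real" where
  "r_opt \<alpha>\<^sub>1 R\<^sub>1 \<alpha>\<^sub>2 R\<^sub>2 =
     (if \<alpha>\<^sub>1 * \<alpha>\<^sub>2 \<ge> 0
      then (\<alpha>\<^sub>1\<^sup>2 + \<alpha>\<^sub>2\<^sup>2 + \<alpha>\<^sub>1 * \<alpha>\<^sub>2 * (trace (transpose R\<^sub>1 ** R\<^sub>2) - 1)) / 4
      else (\<alpha>\<^sub>1 + \<alpha>\<^sub>2)\<^sup>2 / 4)"

end

theory Submission
  imports Defs "HOL-Real_Asymp.Real_Asymp"
begin

text \<open>An input with Bloch vector \<open>r\<close> is sent to Bloch vectors of lengths \<open>|\<alpha>\<^sub>1| |r|\<close> and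
  \<open>|\<alpha>\<^sub>2| |r|\<close>, so for fixed \<open>|r|\<close> the divergence is largest when the averaged output is
  shortest; by Euler's theorem on the rotation \<open>R\<^sub>1\<^sup>T R\<^sub>2\<close> the least length is \<open>m |r|\<close> with
  \<open>m\<^sup>2\<close> the optimal argument. Pure inputs are optimal: for \<open>s \<le> 1\<close> and \<open>h x\<close> the entropy at
  Bloch length \<open>x\<close>, the function \<open>h (s x) - h x\<close> is even and convex, hence increasing on \<open>[0, 1]\<close>,
  and \<open>m \<le> (|\<alpha>\<^sub>1| + |\<alpha>\<^sub>2|) / 2\<close>, so passing from radius \<open>s\<close> to radius \<open>1\<close> does not decrease
  \<open>h (s m) - (h (s |\<alpha>\<^sub>1|) + h (s |\<alpha>\<^sub>2|)) / 2\<close>.\<close>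


section \<open>Entropy as a function of the Bloch length\<close>

lemma continuous_on_x_log_x: "continuous_on {0..} (\<lambda>x::real. x * log 2 x)"
  unfolding continuous_on_eq_continuous_within
proof
  fix x :: real assume x: "x \<in> {0..}"
  show "continuous (at x within {0..}) (\<lambda>x. x * log 2 x)"
  proof (cases "x = 0")
    case True
    \<comment> \<open>The factor \<open>x\<close> makes the value at 0 equal to 0, which is also the
      limit from the right.\<close>
    have "((\<lambda>x::real. x * log 2 x) \<longlongrightarrow> 0) (at_right 0)" by real_asymp
    then show ?thesis
      by (simp add: True continuous_within at_within_Ici_at_right)
  next
    case False
    then have "isCont (\<lambda>x. x * log 2 x) x"
      using x by (intro continuous_intros) auto
    then show ?thesis by (rule continuous_at_imp_continuous_at_within)
  qed
qed

lemma continuous_on_binary_entropy: "continuous_on {0..1} binary_entropy"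
proof -
  have "continuous_on {0..1} (\<lambda>x. - (x * log 2 x) - (1 - x) * log 2 (1 - x))"
    by (intro continuous_on_diff continuous_on_minus
        continuous_on_subset[OF continuous_on_x_log_x]
        continuous_on_compose2[OF continuous_on_x_log_x]) (auto intro!: continuous_intros)
  then show ?thesis by (simp only: binary_entropy_def[abs_def] mult_minus_left)
qed

lemma binary_entropy_compl: "binary_entropy (1 - x) = binary_entropy x"
  by (simp add: binary_entropy_def algebra_simps)

lemma binary_entropy_has_derivative:
  assumes "0 < x" "x < 1"
  shows "(binary_entropy has_real_derivative log 2 (1 - x) - log 2 x) (at x)"
  unfolding binary_entropy_def[abs_def]
  by (rule derivative_eq_intros refl | use assms in \<open>simp add: field_simps log_def\<close>)+

text \<open>The derivative of the entropy blows up at -1 and 1, so a second-derivative test works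
  only in the open interval. Contracting the points by a factor k < 1 moves them inside, and by
  continuity the inequality survives the limit k to 1.\<close>

lemma convex_on_Icc_of_Ioo:
  fixes g :: "real \<Rightarrow> real"
  assumes cont: "continuous_on {-1..1} g" and conv: "convex_on {-1<..<1} g"
  shows "convex_on {-1..1} g"
proof (rule convex_onI)
  have lim: "((\<lambda>k. g (k * x)) \<longlongrightarrow> g x) (at_left 1)" if x: "x \<in> {-1..1}" for x
  proof -
    have "k * x \<in> {-1..1}" if "k \<in> {0..1}" for k
    proof -
      have "\<bar>k * x\<bar> \<le> 1" unfolding abs_mult using that x by (intro mult_le_one) auto
      then show ?thesis by auto
    qed
    then have "continuous_on {0..1} (\<lambda>k. g (k * x))"
      by (intro continuous_on_compose2[OF cont] continuous_intros) auto
    then have "((\<lambda>k. g (k * x)) \<longlongrightarrow> g (1 * x)) (at 1 within {0..1})"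
      unfolding continuous_on_def by (rule bspec) simp
    then show ?thesis by (simp add: at_within_Icc_at_left)
  qed
  fix t x y :: real
  assume t: "0 < t" "t < 1" and x: "x \<in> {-1..1}" and y: "y \<in> {-1..1}"
  have xy: "(1 - t) *\<^sub>R x + t *\<^sub>R y \<in> {-1..1}"
    using t x y by (intro convexD) auto
  show "g ((1 - t) *\<^sub>R x + t *\<^sub>R y) \<le> (1 - t) * g x + t * g y"
  proof (rule tendsto_le[OF trivial_limit_at_left_real tendsto_add[OF tendsto_mult_left[OF lim[OF x]]
          tendsto_mult_left[OF lim[OF y]]] lim[OF xy]])
    have "eventually (\<lambda>k. k \<in> {0<..<1}) (at_left (1::real))"
      by (rule eventually_at_leftI[of 0]) auto
    then show "eventually (\<lambda>k. g (k * ((1 - t) *\<^sub>R x + t *\<^sub>R y))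
        \<le> (1 - t) * g (k * x) + t * g (k * y)) (at_left 1)"
    proof eventually_elim
      case (elim k)
      have in_open: "k * z \<in> {-1<..<1}" if "z \<in> {-1..1}" for z
      proof -
        have "\<bar>k * z\<bar> \<le> k * 1" unfolding abs_mult using elim that by (intro mult_mono) auto
        then show ?thesis using elim by auto
      qed
      show ?case
        using convex_onD[OF conv, of t "k * x" "k * y"] t in_open[OF x] in_open[OF y]
        by (simp add: algebra_simps)
    qed
  qed
qed auto

text \<open>Using the length instead of its square, with negative values allowed, gives an even
  function on [-1, 1]; evenness later turns convexity into monotonicity.\<close>

definition radial_entropy :: "real \<Rightarrow> real" where
  "radial_entropy x = binary_entropy ((1 - x) / 2)"

lemma radial_entropy_minus: "radial_entropy (- x) = radial_entropy x"
  using binary_entropy_compl[of "(1 - x) / 2"]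
  by (simp add: radial_entropy_def field_simps)

lemma continuous_on_radial_entropy: "continuous_on {-1..1} radial_entropy"
  unfolding radial_entropy_def
  by (rule continuous_on_compose2[OF continuous_on_binary_entropy]) (auto intro!: continuous_intros)

lemma radial_entropy_has_derivative:
  assumes "-1 < x" "x < 1"
  shows "(radial_entropy has_real_derivative (log 2 (1 - x) - log 2 (1 + x)) / 2) (at x)"
proof -
  have "((\<lambda>x. binary_entropy ((1 - x) / 2)) has_real_derivative
      (log 2 (1 - (1 - x) / 2) - log 2 ((1 - x) / 2)) * (- 1 / 2)) (at x)"
    using assms
    by (intro DERIV_chain2[OF binary_entropy_has_derivative])
       (auto intro!: derivative_eq_intros)
  moreover have "(log 2 (1 - (1 - x) / 2) - log 2 ((1 - x) / 2)) * (- 1 / 2)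
      = (log 2 (1 - x) - log 2 (1 + x)) / 2"
  proof -
    have "1 - (1 - x) / 2 = (1 + x) / 2" by (simp add: field_simps)
    then have "log 2 (1 - (1 - x) / 2) = log 2 (1 + x) - 1" "log 2 ((1 - x) / 2) = log 2 (1 - x) - 1"
      using assms by (simp_all only: log_divide) simp_all
    then show ?thesis by (simp only:) (simp add: field_simps)
  qed
  ultimately show ?thesis
    unfolding radial_entropy_def by (simp only:)
qed

lemma radial_entropy_has_second_derivative:
  assumes "-1 < x" "x < 1"
  shows "((\<lambda>x. (log 2 (1 - x) - log 2 (1 + x)) / 2) has_real_derivative
    - (1 / (1 - x\<^sup>2) / ln 2)) (at x)"
proof -
  have "1 - x\<^sup>2 = (1 - x) * (1 + x)" by (simp add: power2_eq_square algebra_simps)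
  moreover have "((\<lambda>x. (log 2 (1 - x) - log 2 (1 + x)) / 2) has_real_derivative
      (- (1 / (ln 2 * (1 - x))) - 1 / (ln 2 * (1 + x))) / 2) (at x)"
    using assms by (auto intro!: derivative_eq_intros)
  moreover have "(- (1 / (ln 2 * (1 - x))) - 1 / (ln 2 * (1 + x))) / 2
      = - (1 / ((1 - x) * (1 + x)) / ln 2)"
    using assms by (simp add: divide_simps)
  ultimately show ?thesis by simp
qed

text \<open>The first term is concave, but its curvature is dominated by that of the second: up to
  the factor 1 / ln 2, the second derivative is the difference of 1 / (1 - x^2) and s^2 / (1 - (s
  x)^2).\<close>

lemma convex_on_radial_entropy_diff:
  assumes s: "0 \<le> s" "s \<le> 1"
  shows "convex_on {-1..1} (\<lambda>x. radial_entropy (s * x) - radial_entropy x)"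
proof (rule convex_on_Icc_of_Ioo)
  have sx: "\<bar>s * x\<bar> \<le> \<bar>x\<bar>" for x
    unfolding abs_mult using s by (simp add: mult_left_le_one_le)
  then have sx1: "s * x \<in> {-1..1}" if "x \<in> {-1..1}" for x
    using sx[of x] that unfolding greaterThanLessThan_iff atLeastAtMost_iff by linarith+
  show "continuous_on {-1..1} (\<lambda>x. radial_entropy (s * x) - radial_entropy x)"
    using sx1
    by (intro continuous_on_diff continuous_on_radial_entropy
        continuous_on_compose2[OF continuous_on_radial_entropy]) (auto intro!: continuous_intros)
  have bnd: "-1 < s * x" "s * x < 1" if "x \<in> {-1<..<1}" for x
    using sx[of x] that unfolding greaterThanLessThan_iff atLeastAtMost_iff by linarith+
  show "convex_on {-1<..<1} (\<lambda>x. radial_entropy (s * x) - radial_entropy x)"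
  proof (rule f''_ge0_imp_convex)
    fix x :: real assume x: "x \<in> {-1<..<1}"
    show "((\<lambda>x. radial_entropy (s * x) - radial_entropy x) has_real_derivative
        s * ((log 2 (1 - s * x) - log 2 (1 + s * x)) / 2)
          - (log 2 (1 - x) - log 2 (1 + x)) / 2) (at x)"
      using x bnd[OF x]
      by (intro DERIV_diff radial_entropy_has_derivative
          DERIV_chain2[OF radial_entropy_has_derivative, THEN DERIV_cong])
         (auto intro!: derivative_eq_intros)
    show "((\<lambda>x. s * ((log 2 (1 - s * x) - log 2 (1 + s * x)) / 2)
          - (log 2 (1 - x) - log 2 (1 + x)) / 2) has_real_derivative
        (1 / (1 - x\<^sup>2) - s\<^sup>2 / (1 - (s * x)\<^sup>2)) / ln 2) (at x)"
      using x bnd[OF x]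
      by (intro DERIV_cong[OF DERIV_diff[OF DERIV_cmult[OF
              DERIV_chain2[OF radial_entropy_has_second_derivative]]
            radial_entropy_has_second_derivative]])
         (auto intro!: derivative_eq_intros simp: power2_eq_square diff_divide_distrib)
    \<comment> \<open>After cancellation of the common term this is s^2 \<le> 1.\<close>
    have "s\<^sup>2 * (1 - x\<^sup>2) \<le> 1 * (1 - (s * x)\<^sup>2)"
      using s by (simp add: algebra_simps power_mult_distrib power_le_one)
    moreover have "x\<^sup>2 < 1" "(s * x)\<^sup>2 < 1"
      using x bnd[OF x] by (auto simp: abs_square_less_1)
    ultimately have "s\<^sup>2 / (1 - (s * x)\<^sup>2) \<le> 1 / (1 - x\<^sup>2)"
      by (simp add: divide_simps)
    then show "(1 / (1 - x\<^sup>2) - s\<^sup>2 / (1 - (s * x)\<^sup>2)) / ln 2 \<ge> 0"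
      by simp
  qed auto
qed

text \<open>The point x lies between - y and y, where g takes the same value, so convexity bounds g
  x by that value.\<close>

lemma even_convex_mono:
  fixes g :: "real \<Rightarrow> real"
  assumes conv: "convex_on {-1..1} g" and even: "\<And>x. g (- x) = g x"
    and xy: "0 \<le> x" "x \<le> y" "y \<le> 1"
  shows "g x \<le> g y"
proof (cases "y = 0")
  case False
  \<comment> \<open>The solution of (1 - t) (- y) + t y = x, whence the separate case y = 0.\<close>
  define t where "t = (1 + x / y) / 2"
  have t: "0 \<le> t" "t \<le> 1" using xy False by (auto simp: t_def field_simps)
  have "(1 - t) * - y + t * y = x" using False by (simp add: t_def field_simps)
  then show ?thesis
    using convex_onD[OF conv t, of "- y" y] xy by (simp add: even algebra_simps)
qed (use xy in simp)

text \<open>The case s = 0, where the even convex function is a constant minus the entropy.\<close>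

lemma radial_entropy_antimono:
  assumes "0 \<le> x" "x \<le> y" "y \<le> 1"
  shows "radial_entropy y \<le> radial_entropy x"
  using even_convex_mono[OF convex_on_radial_entropy_diff[of 0], of x y] assms
  by (simp add: radial_entropy_minus)

text \<open>With g x the entropy at s x minus the entropy at x, the claim reads g m \<le> (g a + g
  b) / 2: monotonicity moves m up to the midpoint of a and b, and convexity does the rest.\<close>

lemma radial_entropy_jensen_gap_mono:
  assumes s: "0 \<le> s" "s \<le> 1" and ab: "0 \<le> a" "a \<le> 1" "0 \<le> b" "b \<le> 1"
    and m: "0 \<le> m" "m \<le> (a + b) / 2"
  shows "radial_entropy (s * m) - (radial_entropy (s * a) + radial_entropy (s * b)) / 2
    \<le> radial_entropy m - (radial_entropy a + radial_entropy b) / 2"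
proof -
  let ?g = "\<lambda>x. radial_entropy (s * x) - radial_entropy x"
  note conv = convex_on_radial_entropy_diff[OF s]
  have "?g m \<le> ?g ((a + b) / 2)"
    using m ab by (intro even_convex_mono[OF conv]) (auto simp: radial_entropy_minus)
  also have "\<dots> \<le> (?g a + ?g b) / 2"
    using convex_onD[OF conv, of "1/2" a b] ab by (simp add: add_divide_distrib)
  finally show ?thesis by (simp add: field_simps)
qed


section \<open>Bloch representation\<close>

lemma conj_transpose_nth [simp]: "conj_transpose A $ i $ j = cnj (A $ j $ i)"
  by (simp add: conj_transpose_def transpose_def map_matrix_def)

lemma bloch_state_nth:
  "bloch_state r $ 1 $ 1 = complex_of_real ((1 + r $ 3) / 2)"
  "bloch_state r $ 1 $ 2 = Complex (r $ 1 / 2) (- r $ 2 / 2)"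
  "bloch_state r $ 2 $ 1 = Complex (r $ 1 / 2) (r $ 2 / 2)"
  "bloch_state r $ 2 $ 2 = complex_of_real ((1 - r $ 3) / 2)"
  by (simp_all add: bloch_state_def pauli_x_def pauli_y_def pauli_z_def mat_def complex_eq_iff)

lemma bloch_state_average:
  "(1/2) *\<^sub>R (bloch_state r + bloch_state s) = bloch_state ((1/2) *\<^sub>R (r + s))"
  by (simp add: vec_eq_iff forall_2 bloch_state_nth complex_eq_iff field_simps)

lemma norm_vec3_power2: "(norm (r :: real^3))\<^sup>2 = (r $ 1)\<^sup>2 + (r $ 2)\<^sup>2 + (r $ 3)\<^sup>2"
  unfolding power2_norm_eq_inner by (simp add: inner_vec_def sum_3 power2_eq_square)

lemma unitary_matrix_2_iff:
  fixes U :: "complex^2^2"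
  shows "unitary_matrix U \<longleftrightarrow> conj_transpose U ** U = mat 1"
  using matrix_left_right_inverse[of "conj_transpose U" U] by (auto simp: unitary_matrix_def)

text \<open>The two columns are the eigenvectors \<open>(n + r\<^sub>3, r\<^sub>1 + \<i> r\<^sub>2)\<close> and
  \<open>(- r\<^sub>1 + \<i> r\<^sub>2, n + r\<^sub>3)\<close>, where \<open>n = norm r\<close>, of squared length \<open>2 n (n + r\<^sub>3)\<close>. They vanish
  for \<open>r\<^sub>3 = - n\<close>, where \<open>pauli_x\<close> does the job.\<close>

lemma bloch_state_diagonalised:
  obtains U where "unitary_matrix U"
    and "bloch_state r = U ** real_diag (\<lambda>i. if i = 1 then (1 + norm r) / 2 else (1 - norm r) / 2)
      ** conj_transpose U"
proof (cases "norm r + r $ 3 = 0")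
  case True
  then have r3: "r $ 3 = - norm r" by simp
  then have "(r $ 1)\<^sup>2 + (r $ 2)\<^sup>2 = 0"
    using norm_vec3_power2[of r] by simp
  then have r12: "r $ 1 = 0" "r $ 2 = 0" by (simp_all add: sum_power2_eq_zero_iff)
  show ?thesis
  proof
    show "unitary_matrix pauli_x"
      by (simp add: unitary_matrix_2_iff pauli_x_def vec_eq_iff forall_2 matrix_matrix_mult_def
          sum_2 mat_def)
    show "bloch_state r = pauli_x ** real_diag (\<lambda>i. if i = 1 then (1 + norm r) / 2 else (1 - norm r) / 2)
      ** conj_transpose pauli_x"
      by (simp add: vec_eq_iff forall_2 bloch_state_nth r12 r3 pauli_x_def matrix_matrix_mult_def
          sum_2 real_diag_def complex_eq_iff)
  qed
next
  case False
  define n where "n = norm r"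
  define a where "a = n + r $ 3"
  have n2: "n\<^sup>2 = (r $ 1)\<^sup>2 + (r $ 2)\<^sup>2 + (r $ 3)\<^sup>2"
    unfolding n_def by (rule norm_vec3_power2)
  have "\<bar>r $ 3\<bar> \<le> n" unfolding n_def by (rule component_le_norm_cart)
  with False have a: "0 < a" "0 < n" by (auto simp: a_def n_def)
  define N where "N = sqrt (2 * n * a)"
  have NN: "N * N = 2 * n * a" using a by (auto simp: N_def)
  have r12: "(r $ 1)\<^sup>2 + (r $ 2)\<^sup>2 = a * (2 * n - a)"
    using n2 by (simp add: a_def power2_eq_square algebra_simps)
  have r3: "r $ 3 = a - n" by (simp add: a_def)
  define x where "x = a / N"
  define p where "p = r $ 1 / N"
  define q where "q = r $ 2 / N"
  \<comment> \<open>The eigenvalues differ by n, so the off-diagonal entries of the product have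
    real part n x p and imaginary part n x q up to sign; the first identity serves the
    diagonal.\<close>
  have xpq: "x * x * n = a / 2" "x * p * n = r $ 1 / 2" "x * q * n = r $ 2 / 2"
    using a by (simp_all add: x_def p_def q_def NN)
  have "x * x + p * p + q * q = (a * a + ((r $ 1)\<^sup>2 + (r $ 2)\<^sup>2)) / (2 * n * a)"
    by (simp add: x_def p_def q_def NN power2_eq_square add_divide_distrib)
  also have "\<dots> = 1"
    using a by (simp add: r12 field_simps)
  \<comment> \<open>Unit length of both columns of \<open>U\<close>; their orthogonality is built
    into its form.\<close>
  finally have 1: "p * p + q * q = 1 - x * x" by simp
  then have "n * (p * p + q * q) = n - a / 2"
    using xpq(1) unfolding 1 by (simp add: algebra_simps)
  then have "n * (p * p) + n * (q * q) = n - a / 2"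
    by (simp only: distrib_left)
  note pq = 1 this
  define U :: "complex^2^2" where
    "U = vector [vector [of_real x, Complex (- p) q], vector [Complex p q, of_real x]]"
  have U: "U $ 1 $ 1 = of_real x" "U $ 1 $ 2 = Complex (- p) q"
    "U $ 2 $ 1 = Complex p q" "U $ 2 $ 2 = of_real x"
    by (simp_all add: U_def)
  show ?thesis
  proof
    show "unitary_matrix U"
      unfolding unitary_matrix_2_iff using pq
      by (simp add: vec_eq_iff forall_2 matrix_matrix_mult_def sum_2 mat_def U complex_eq_iff
          algebra_simps)
    show "bloch_state r = U ** real_diag (\<lambda>i. if i = 1 then (1 + norm r) / 2 else (1 - norm r) / 2)
      ** conj_transpose U"
      unfolding n_def[symmetric] using xpq pq r3
      by (simp add: vec_eq_iff forall_2 matrix_matrix_mult_def sum_2 real_diag_def U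
          complex_eq_iff bloch_state_nth)
        (simp add: field_simps)
  qed
qed

section \<open>Positivity and entropy in terms of eigenvalues\<close>

text \<open>Moving \<open>U\<close> to the left argument as its adjoint makes the form diagonal in
  the coordinates \<open>conj_transpose U *v v\<close>.\<close>

lemma cinner_unitary_conj:
  fixes U :: "complex^'n^'n"
  shows "cinner v ((U ** real_diag d ** conj_transpose U) *v v)
    = complex_of_real (\<Sum>i\<in>UNIV. d i * (cmod ((conj_transpose U *v v) $ i))\<^sup>2)"
proof -
  define w where "w = conj_transpose U *v v"
  have adj: "cinner v (U *v x) = cinner (conj_transpose U *v v) x" for x
    unfolding cinner_def matrix_vector_mult_def
    by (simp add: sum_distrib_left sum_distrib_right cnj_sum mult.assoc mult.left_commute mult.commute)
       (rule sum.swap)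
  have "cinner v ((U ** real_diag d ** conj_transpose U) *v v) = cinner w (real_diag d *v w)"
    by (simp add: w_def adj flip: matrix_vector_mul_assoc)
  also have "\<dots> = (\<Sum>i\<in>UNIV. complex_of_real (d i * (cmod (w $ i))\<^sup>2))"
    unfolding cinner_def
  proof (rule sum.cong)
    fix i
    have "(real_diag d *v w) $ i = of_real (d i) * w $ i"
      by (simp add: matrix_vector_mult_def real_diag_def if_distrib[of "\<lambda>z. z * _"] cong: if_cong)
    then show "cnj (w $ i) * (real_diag d *v w) $ i = complex_of_real (d i * (cmod (w $ i))\<^sup>2)"
      by (simp add: complex_norm_square algebra_simps del: of_real_power)
  qed simp
  finally show ?thesis by (simp add: w_def)
qed

lemma psd_unitary_conj_iff:
  assumes "unitary_matrix U"
  shows "psd (U ** real_diag d ** conj_transpose U) \<longleftrightarrow> (\<forall>i. 0 \<le> d i)"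
proof
  assume psd: "psd (U ** real_diag d ** conj_transpose U)"
  show "\<forall>i. 0 \<le> d i"
  proof
    fix i
    \<comment> \<open>The i-th column of \<open>U\<close> is an eigenvector; testing on it isolates
      \<open>d i\<close>.\<close>
    have "conj_transpose U *v (U *v axis i 1) = axis i 1"
      using assms by (simp add: unitary_matrix_def matrix_vector_mul_assoc)
    then have "cinner (U *v axis i 1) ((U ** real_diag d ** conj_transpose U) *v (U *v axis i 1))
      = complex_of_real (d i)"
      by (simp add: cinner_unitary_conj axis_def if_distrib[of "\<lambda>z. _ * (cmod z)\<^sup>2"] cong: if_cong)
    then show "0 \<le> d i"
      using psd[unfolded psd_def, rule_format, of "U *v axis i 1"] by (simp add: nonneg_Reals_of_real_iff)
  qed
next
  assume "\<forall>i. 0 \<le> d i"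
  then show "psd (U ** real_diag d ** conj_transpose U)"
    by (simp add: psd_def cinner_unitary_conj nonneg_Reals_of_real_iff sum_nonneg del: of_real_sum)
qed

text \<open>Of the eigenvalues (1 + norm r) / 2 and (1 - norm r) / 2 only the second can be
  negative.\<close>

lemma density_bloch_state_iff: "density_matrix (bloch_state r) \<longleftrightarrow> norm r \<le> 1"
proof -
  obtain U where U: "unitary_matrix U"
    and eq: "bloch_state r = U ** real_diag (\<lambda>i. if i = 1 then (1 + norm r) / 2 else (1 - norm r) / 2)
      ** conj_transpose U"
    by (rule bloch_state_diagonalised)
  have "psd (bloch_state r) \<longleftrightarrow> norm r \<le> 1"
    unfolding eq psd_unitary_conj_iff[OF U] using norm_ge_zero[of r]
    by (auto simp: forall_2)
  moreover have "trace (bloch_state r) = 1"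
    by (simp add: trace_def sum_2 bloch_state_nth complex_eq_iff field_simps)
  ultimately show ?thesis by (simp add: density_matrix_def)
qed

text \<open>Reality of the quadratic form at four test vectors makes the matrix Hermitian; unit
  trace then leaves three real parameters, the Bloch vector.\<close>

lemma density_matrix_bloch:
  fixes \<rho> :: "complex^2^2"
  assumes "density_matrix \<rho>"
  obtains r where "norm r \<le> 1" "\<rho> = bloch_state r"
proof -
  have pos: "(\<Sum>i\<in>UNIV. \<Sum>j\<in>UNIV. cnj (v $ i) * (\<rho> $ i $ j * v $ j)) \<in> \<real>\<^sub>\<ge>\<^sub>0" for v
    using assms unfolding density_matrix_def psd_def cinner_def matrix_vector_mult_def
    by (simp add: sum_distrib_left)
  have im11: "Im (\<rho> $ 1 $ 1) = 0" and im22: "Im (\<rho> $ 2 $ 2) = 0"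
    using pos[of "vector [1, 0]"] pos[of "vector [0, 1]"]
    by (auto simp: sum_2 complex_nonneg_Reals_iff)
  \<comment> \<open>The vectors (1, 1) and (1, \<i>) isolate the imaginary part of the sum and the
    real part of the difference of the off-diagonal entries.\<close>
  have im12: "Im (\<rho> $ 1 $ 2) + Im (\<rho> $ 2 $ 1) = 0" and re12: "Re (\<rho> $ 1 $ 2) = Re (\<rho> $ 2 $ 1)"
    using pos[of "vector [1, 1]"] pos[of "vector [1, \<i>]"] im11 im22
    by (auto simp: sum_2 complex_nonneg_Reals_iff)
  have tr: "Re (\<rho> $ 1 $ 1) + Re (\<rho> $ 2 $ 2) = 1"
    using assms by (simp add: density_matrix_def trace_def sum_2 complex_eq_iff)
  define r :: "real^3" where
    "r = vector [2 * Re (\<rho> $ 1 $ 2), 2 * Im (\<rho> $ 2 $ 1), Re (\<rho> $ 1 $ 1) - Re (\<rho> $ 2 $ 2)]"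
  have "\<rho> = bloch_state r"
    using im11 im22 im12 re12 tr
    by (auto simp: vec_eq_iff forall_2 bloch_state_nth complex_eq_iff r_def)
  moreover from this assms have "norm r \<le> 1" by (simp add: density_bloch_state_iff)
  ultimately show ?thesis using that by blast
qed

text \<open>The trace is cyclic, so \<open>U\<close> cancels against its adjoint.\<close>

lemma von_neumann_entropy_unitary_conj:
  assumes "unitary_matrix U"
  shows "von_neumann_entropy (U ** real_diag d ** conj_transpose U)
    = - (\<Sum>i\<in>UNIV. d i * log 2 (d i))"
proof -
  let ?L = "real_diag (\<lambda>i. log 2 (d i))"
  have UU: "conj_transpose U ** U = mat 1" using assms by (simp add: unitary_matrix_def)
  have "trace ((U ** real_diag d ** conj_transpose U) ** (U ** ?L ** conj_transpose U))
      = trace (U ** (real_diag d ** (conj_transpose U ** U) ** ?L ** conj_transpose U))"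
    by (simp only: matrix_mul_assoc)
  also have "\<dots> = trace (real_diag d ** ?L ** conj_transpose U ** U)"
    by (simp add: UU trace_mul_sym[of U])
  also have "\<dots> = trace (real_diag d ** ?L)"
    by (simp add: UU flip: matrix_mul_assoc)
  also have "\<dots> = (\<Sum>i\<in>UNIV. complex_of_real (d i * log 2 (d i)))"
    unfolding trace_def real_diag_matrix_mul by (simp add: real_diag_def)
  finally show ?thesis
    by (simp add: von_neumann_entropy_def matrix_fun_diagonalised[OF assms] del: of_real_mult)
qed

lemma von_neumann_entropy_bloch_state:
  "von_neumann_entropy (bloch_state r) = bloch_entropy ((norm r)\<^sup>2)"
proof -
  obtain U where U: "unitary_matrix U"
    and eq: "bloch_state r = U ** real_diag (\<lambda>i. if i = 1 then (1 + norm r) / 2 else (1 - norm r) / 2)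
      ** conj_transpose U"
    by (rule bloch_state_diagonalised)
  have 1: "1 - (1 - norm r) / 2 = (1 + norm r) / 2" by (simp add: field_simps)
  show ?thesis
    unfolding eq von_neumann_entropy_unitary_conj[OF U]
    by (simp add: sum_2 bloch_entropy_def binary_entropy_def 1)
qed

text \<open>A trivial ancilla: this makes ordinary positivity an instance of complete positivity, so
  that channels map states to states.\<close>

lemma psd_iff_block_psd: "psd A \<longleftrightarrow> block_psd 1 (\<lambda>i j. A)"
proof
  assume "block_psd 1 (\<lambda>i j. A)"
  then show "psd A"
    unfolding psd_def block_psd_def by (intro allI) (drule_tac x="\<lambda>_. v" in spec, simp)
qed (simp add: psd_def block_psd_def)

lemma quantum_channel_density:
  assumes "quantum_channel E" "density_matrix \<rho>"
  shows "density_matrix (E \<rho>)"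
  using assms unfolding quantum_channel_def completely_positive_def trace_preserving_def
    density_matrix_def psd_iff_block_psd
  by auto


section \<open>Rotations of three-dimensional space\<close>

lemma rotation_matrix_mul:
  fixes A B :: "real^'n^'n"
  assumes "rotation_matrix A" "rotation_matrix B"
  shows "rotation_matrix (A ** B)"
  using assms by (simp add: rotation_matrix_def orthogonal_matrix_mul det_mul)

lemma rotation_matrix_transpose:
  fixes A :: "real^'n^'n"
  assumes "rotation_matrix A"
  shows "rotation_matrix (transpose A)"
  using assms by (simp add: rotation_matrix_def orthogonal_matrix_transpose)

lemma inner_transpose_matrix_vector:
  fixes A :: "real^'n^'m"
  shows "x \<bullet> (transpose A *v y) = (A *v x) \<bullet> y"
  by (metis dot_lmul_matrix inner_commute transpose_matrix_vector)

lemma rotation_matrix_norm: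
  fixes A :: "real^'n^'n"
  assumes "rotation_matrix A"
  shows "norm (A *v x) = norm x"
proof -
  have "orthogonal_transformation (\<lambda>x. A *v x)"
    using assms by (simp add: rotation_matrix_def orthogonal_transformation_matrix)
  then show ?thesis by (rule orthogonal_transformation_norm)
qed

text \<open>Euler: \<open>det (R - 1) = det (R\<^sup>T (R - 1)) = det ((1 - R)\<^sup>T) = - det (R - 1)\<close> in dimension 3.\<close>

lemma rotation_matrix_axis:
  fixes R :: "real^3^3"
  assumes "rotation_matrix R"
  obtains a where "norm a = 1" "R *v a = a"
proof -
  have R: "transpose R ** R = mat 1" "det R = 1"
    using assms by (auto simp: rotation_matrix_def orthogonal_matrix)
  have "transpose R ** (R - mat 1) = transpose (- (R - mat 1))"
  proof -
    have "transpose R ** (R - mat 1) = transpose R ** R - transpose R ** mat 1"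
      by (simp add: vec_eq_iff matrix_matrix_mult_def right_diff_distrib sum_subtractf)
    also have "\<dots> = mat 1 - transpose R" by (simp add: R(1))
    also have "\<dots> = transpose (- (R - mat 1))" by (simp add: transpose_def vec_eq_iff mat_def)
    finally show ?thesis .
  qed
  then have "det (transpose R) * det (R - mat 1) = det (- (R - mat 1))"
    by (metis det_mul det_transpose)
  also have "\<dots> = - det (R - mat 1)"
    by (simp add: det_3 algebra_simps)
  finally have "det (R - mat 1) = 0" using R by simp
  then have "\<not> invertible (R - mat 1)" by (simp add: invertible_det_nz)
  then obtain x where x: "x \<noteq> 0" "(R - mat 1) *v x = 0"
    by (auto simp: invertible_left_inverse matrix_left_invertible_ker)
  then have "R *v x = x" by (simp add: matrix_vector_mult_diff_rdistrib)
  then have "norm (x /\<^sub>R norm x) = 1" "R *v (x /\<^sub>R norm x) = x /\<^sub>R norm x"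
    using x(1) by (simp_all add: matrix_vector_mult_scaleR)
  then show ?thesis by (rule that)
qed

text \<open>Orthogonality and determinant 1 force \<open>T\<close> to be block diagonal, with entry
  1 and a planar rotation by some angle \<theta>; then (trace T - 1) / 2 is cos \<theta>.\<close>

lemma rotation_matrix_fix_axis_1:
  fixes T :: "real^3^3"
  assumes T: "rotation_matrix T" and fix1: "T *v axis 1 1 = axis 1 1"
  shows "y \<bullet> (T *v y) = (y $ 1)\<^sup>2 + (trace T - 1) / 2 * ((y $ 2)\<^sup>2 + (y $ 3)\<^sup>2)"
    and "trace T \<le> 3"
proof -
  have o: "transpose T ** T = mat 1" "T ** transpose T = mat 1" and det: "det T = 1"
    using T by (auto simp: rotation_matrix_def orthogonal_matrix_def)
  have c: "T $ 1 $ 1 = 1" "T $ 2 $ 1 = 0" "T $ 3 $ 1 = 0"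
    using fix1 by (auto simp: vec_eq_iff forall_3 matrix_vector_mult_def sum_3 axis_def)
  have "(T $ 1 $ 2)\<^sup>2 + (T $ 1 $ 3)\<^sup>2 = 0"
    using o(2)[THEN arg_cong, of "\<lambda>M. M $ 1 $ 1"]
    by (simp add: matrix_matrix_mult_def transpose_def sum_3 mat_def c power2_eq_square)
  then have r: "T $ 1 $ 2 = 0" "T $ 1 $ 3 = 0"
    by (simp_all add: sum_power2_eq_zero_iff)
  have e: "T $ 2 $ 2 * T $ 2 $ 2 + T $ 3 $ 2 * T $ 3 $ 2 = 1"
    "T $ 2 $ 3 * T $ 2 $ 3 + T $ 3 $ 3 * T $ 3 $ 3 = 1"
    using o(1)[THEN arg_cong, of "\<lambda>M. M $ 2 $ 2"] o(1)[THEN arg_cong, of "\<lambda>M. M $ 3 $ 3"]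
    by (simp_all add: matrix_matrix_mult_def transpose_def sum_3 mat_def r)
  have d: "T $ 2 $ 2 * T $ 3 $ 3 - T $ 2 $ 3 * T $ 3 $ 2 = 1"
    using det by (simp add: det_3 c r)
  \<comment> \<open>Expanded, this is the sum of the two squared column lengths minus twice the
    determinant of the block, that is 2 - 2.\<close>
  have "(T $ 2 $ 2 - T $ 3 $ 3)\<^sup>2 + (T $ 2 $ 3 + T $ 3 $ 2)\<^sup>2 = 0"
    using e d by (simp add: power2_eq_square algebra_simps)
  then have s: "T $ 2 $ 2 = T $ 3 $ 3" "T $ 2 $ 3 = - T $ 3 $ 2"
    by (simp_all add: sum_power2_eq_zero_iff)
  have tr: "trace T = 1 + 2 * T $ 3 $ 3"
    by (simp add: trace_def sum_3 c s)
  show "y \<bullet> (T *v y) = (y $ 1)\<^sup>2 + (trace T - 1) / 2 * ((y $ 2)\<^sup>2 + (y $ 3)\<^sup>2)"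
    unfolding tr
    by (simp add: inner_vec_def matrix_vector_mult_def sum_3 c r s power2_eq_square algebra_simps)
  have "(T $ 3 $ 3)\<^sup>2 \<le> 1"
    using e(2) zero_le_square[of "T $ 2 $ 3"] unfolding power2_eq_square by linarith
  then have "T $ 3 $ 3 \<le> 1" by (simp add: abs_square_le_1)
  then show "trace T \<le> 3" by (simp add: tr)
qed

text \<open>Conjugation by \<open>Q\<close> puts the rotation axis on the first coordinate axis and
  preserves trace and inner products. The component along the axis then counts with factor 1, the
  rest with cos \<theta> \<le> 1, so the minimum lies in the plane orthogonal to the axis.\<close>

lemma rotation_matrix_inner_lower:
  fixes R :: "real^3^3"
  assumes R: "rotation_matrix R"
  shows "(trace R - 1) / 2 * (norm x)\<^sup>2 \<le> x \<bullet> (R *v x)"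
    and "\<exists>u. norm u = 1 \<and> u \<bullet> (R *v u) = (trace R - 1) / 2"
proof -
  obtain a where a: "norm a = 1" "R *v a = a" using rotation_matrix_axis[OF R] .
  obtain Q where Q: "rotation_matrix Q" "Q *v axis 1 1 = a"
    using rotation_matrix_exists_basis[of a 1] a by auto
  define T where "T = transpose Q ** R ** Q"
  have oQ: "transpose Q ** Q = mat 1" "Q ** transpose Q = mat 1"
    using Q by (auto simp: rotation_matrix_def orthogonal_matrix_def)
  have T: "rotation_matrix T"
    unfolding T_def by (intro rotation_matrix_mul rotation_matrix_transpose Q R)
  have "transpose Q *v a = axis 1 1"
    using Q(2) oQ(1) by (metis matrix_vector_mul_assoc matrix_vector_mul_lid)
  then have T1: "T *v axis 1 1 = axis 1 1"
    by (simp add: T_def Q(2) a(2) del: transpose_matrix_vector flip: matrix_vector_mul_assoc)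
  have trT: "trace T = trace R"
    unfolding T_def trace_mul_sym[of _ Q] by (simp add: oQ matrix_mul_assoc)
  have inner: "(Q *v y) \<bullet> (R *v (Q *v y)) = y \<bullet> (T *v y)" for y
    by (simp add: T_def inner_transpose_matrix_vector del: transpose_matrix_vector flip: matrix_vector_mul_assoc)
  note quad = rotation_matrix_fix_axis_1[OF T T1, unfolded trT]
  show "\<exists>u. norm u = 1 \<and> u \<bullet> (R *v u) = (trace R - 1) / 2"
    by (rule exI[of _ "Q *v axis 2 1"])
       (simp add: rotation_matrix_norm[OF Q(1)] inner quad axis_def[of 2] norm_axis_1[unfolded axis_def])
  define y where "y = transpose Q *v x"
  have x: "x = Q *v y"
    by (simp add: y_def matrix_vector_mul_assoc oQ del: transpose_matrix_vector)
  have "(norm x)\<^sup>2 = y \<bullet> y"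
    by (simp add: x rotation_matrix_norm[OF Q(1)] power2_norm_eq_inner)
  also have "\<dots> = (y $ 1)\<^sup>2 + ((y $ 2)\<^sup>2 + (y $ 3)\<^sup>2)"
    by (simp add: inner_vec_def sum_3 power2_eq_square)
  finally have n: "(norm x)\<^sup>2 = (y $ 1)\<^sup>2 + ((y $ 2)\<^sup>2 + (y $ 3)\<^sup>2)" .
  have "(trace R - 1) / 2 * (y $ 1)\<^sup>2 \<le> 1 * (y $ 1)\<^sup>2"
    using quad(2) by (intro mult_right_mono) auto
  then show "(trace R - 1) / 2 * (norm x)\<^sup>2 \<le> x \<bullet> (R *v x)"
    unfolding n by (simp add: x inner quad algebra_simps)
qed

section \<open>The shortest averaged output\<close>

lemma norm_average_rotations_power2:
  fixes R\<^sub>1 R\<^sub>2 :: "real^3^3"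
  assumes "rotation_matrix R\<^sub>1" "rotation_matrix R\<^sub>2"
  shows "(norm ((1/2) *\<^sub>R ((\<alpha>\<^sub>1 *\<^sub>R R\<^sub>1) *v x + (\<alpha>\<^sub>2 *\<^sub>R R\<^sub>2) *v x)))\<^sup>2
    = ((\<alpha>\<^sub>1\<^sup>2 + \<alpha>\<^sub>2\<^sup>2) * (norm x)\<^sup>2 + 2 * \<alpha>\<^sub>1 * \<alpha>\<^sub>2 * (x \<bullet> ((transpose R\<^sub>1 ** R\<^sub>2) *v x))) / 4"
proof -
  let ?u = "R\<^sub>1 *v x" and ?v = "R\<^sub>2 *v x"
  have uu: "?u \<bullet> ?u = (norm x)\<^sup>2" "?v \<bullet> ?v = (norm x)\<^sup>2"
    using assms by (simp_all add: rotation_matrix_norm flip: power2_norm_eq_inner)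
  have uv: "x \<bullet> ((transpose R\<^sub>1 ** R\<^sub>2) *v x) = ?u \<bullet> ?v"
    by (simp add: inner_transpose_matrix_vector del: transpose_matrix_vector flip: matrix_vector_mul_assoc)
  have "(norm ((1/2) *\<^sub>R (\<alpha>\<^sub>1 *\<^sub>R ?u + \<alpha>\<^sub>2 *\<^sub>R ?v)))\<^sup>2
      = (\<alpha>\<^sub>1\<^sup>2 * (?u \<bullet> ?u) + \<alpha>\<^sub>2\<^sup>2 * (?v \<bullet> ?v) + 2 * \<alpha>\<^sub>1 * \<alpha>\<^sub>2 * (?u \<bullet> ?v)) / 4"
    unfolding power2_norm_eq_inner
    by (simp add: inner_add_left inner_add_right inner_commute[of ?v ?u] power2_eq_square
        algebra_simps)
  then show ?thesis
    by (simp add: uu uv algebra_simps flip: scaleR_matrix_vector_assoc)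
qed

text \<open>The sign of the product of the scale factors decides whether the form of the relative
  rotation should be small, as orthogonally to its axis, or large, where Cauchy-Schwarz caps it with
  equality on the axis. Homogeneity in x lets the bound cover mixed inputs.\<close>

lemma norm_average_rotations_lower:
  fixes R\<^sub>1 R\<^sub>2 :: "real^3^3"
  assumes R: "rotation_matrix R\<^sub>1" "rotation_matrix R\<^sub>2"
  shows "r_opt \<alpha>\<^sub>1 R\<^sub>1 \<alpha>\<^sub>2 R\<^sub>2 * (norm x)\<^sup>2
      \<le> (norm ((1/2) *\<^sub>R ((\<alpha>\<^sub>1 *\<^sub>R R\<^sub>1) *v x + (\<alpha>\<^sub>2 *\<^sub>R R\<^sub>2) *v x)))\<^sup>2" (is ?lower)
    and "\<exists>u. norm u = 1
      \<and> (norm ((1/2) *\<^sub>R ((\<alpha>\<^sub>1 *\<^sub>R R\<^sub>1) *v u + (\<alpha>\<^sub>2 *\<^sub>R R\<^sub>2) *v u)))\<^sup>2 = r_opt \<alpha>\<^sub>1 R\<^sub>1 \<alpha>\<^sub>2 R\<^sub>2" (is ?attained)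
proof -
  define R where "R = transpose R\<^sub>1 ** R\<^sub>2"
  have rot: "rotation_matrix R"
    unfolding R_def by (intro rotation_matrix_mul rotation_matrix_transpose R)
  note eq = norm_average_rotations_power2[OF R, folded R_def]
  have both: "?lower \<and> ?attained"
  proof (cases "\<alpha>\<^sub>1 * \<alpha>\<^sub>2 \<ge> 0")
    case True
    then have opt: "r_opt \<alpha>\<^sub>1 R\<^sub>1 \<alpha>\<^sub>2 R\<^sub>2
        = (\<alpha>\<^sub>1\<^sup>2 + \<alpha>\<^sub>2\<^sup>2 + 2 * (\<alpha>\<^sub>1 * \<alpha>\<^sub>2) * ((trace R - 1) / 2)) / 4"
      by (simp add: r_opt_def R_def)
    have "(\<alpha>\<^sub>1 * \<alpha>\<^sub>2) * ((trace R - 1) / 2 * (norm x)\<^sup>2) \<le> (\<alpha>\<^sub>1 * \<alpha>\<^sub>2) * (x \<bullet> (R *v x))"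
      by (intro mult_left_mono rotation_matrix_inner_lower rot True)
    then have ?lower unfolding eq opt by (simp add: algebra_simps)
    moreover obtain u where "norm u = 1" "u \<bullet> (R *v u) = (trace R - 1) / 2"
      using rotation_matrix_inner_lower(2)[OF rot] by blast
    then have ?attained unfolding eq opt by (intro exI[of _ u]) simp
    ultimately show ?thesis ..
  next
    case False
    then have opt: "r_opt \<alpha>\<^sub>1 R\<^sub>1 \<alpha>\<^sub>2 R\<^sub>2 = (\<alpha>\<^sub>1\<^sup>2 + \<alpha>\<^sub>2\<^sup>2 + 2 * \<alpha>\<^sub>1 * \<alpha>\<^sub>2) / 4"
      by (simp add: r_opt_def power2_sum)
    have "x \<bullet> (R *v x) \<le> norm x * norm (R *v x)" by (rule norm_cauchy_schwarz)
    also have "\<dots> = (norm x)\<^sup>2"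
      by (simp add: rotation_matrix_norm[OF rot] power2_eq_square)
    finally have "(\<alpha>\<^sub>1 * \<alpha>\<^sub>2) * (norm x)\<^sup>2 \<le> (\<alpha>\<^sub>1 * \<alpha>\<^sub>2) * (x \<bullet> (R *v x))"
      using False by (intro mult_left_mono_neg) auto
    then have ?lower unfolding eq opt by (simp add: algebra_simps)
    moreover obtain u where "norm u = 1" "R *v u = u"
      using rotation_matrix_axis[OF rot] .
    then have ?attained
      unfolding eq opt by (intro exI[of _ u]) (simp flip: power2_norm_eq_inner)
    ultimately show ?thesis ..
  qed
  show ?lower by (rule conjunct1[OF both])
  show ?attained by (rule conjunct2[OF both])
qed


section \<open>The channel divergence\<close>

text \<open>A pure input has Bloch length 1, and its output is again a state, of Bloch length
  \<bar>\<alpha>\<bar>.\<close>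

lemma quantum_channel_scale_le_1:
  fixes R :: "real^3^3"
  assumes "quantum_channel E" "has_distortion_matrix E (\<alpha> *\<^sub>R R)" "rotation_matrix R"
  shows "\<bar>\<alpha>\<bar> \<le> 1"
proof -
  define e :: "real^3" where "e = axis 1 1"
  have e: "norm e = 1" by (simp add: e_def norm_axis_1)
  then have "density_matrix (E (bloch_state e))"
    by (simp add: quantum_channel_density[OF assms(1)] density_bloch_state_iff)
  also have "E (bloch_state e) = bloch_state ((\<alpha> *\<^sub>R R) *v e)"
    using assms(2) e by (simp add: has_distortion_matrix_def)
  finally show ?thesis
    by (simp add: density_bloch_state_iff rotation_matrix_norm[OF assms(3)] e
        flip: scaleR_matrix_vector_assoc)
qed

lemma bloch_entropy_radial: "bloch_entropy x = radial_entropy (sqrt x)"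
  by (simp add: bloch_entropy_def radial_entropy_def)

lemma QJSD_bloch_state:
  "QJSD (bloch_state u) (bloch_state v)
    = radial_entropy (norm ((1/2) *\<^sub>R (u + v))) - (radial_entropy (norm u) + radial_entropy (norm v)) / 2"
  unfolding QJSD_def bloch_state_average von_neumann_entropy_bloch_state bloch_entropy_radial
  by (simp only: real_sqrt_abs abs_norm_cancel) (simp add: add_divide_distrib)

theorem proposition4:
  fixes E\<^sub>1 E\<^sub>2 :: "complex^2^2 \<Rightarrow> complex^2^2"
    and \<Lambda>\<^sub>1 \<Lambda>\<^sub>2 R\<^sub>1 R\<^sub>2 :: "real^3^3"
    and \<alpha>\<^sub>1 \<alpha>\<^sub>2 :: real
  assumes "quantum_channel E\<^sub>1" and "unital E\<^sub>1"
    and "quantum_channel E\<^sub>2" and "unital E\<^sub>2"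
    and "has_distortion_matrix E\<^sub>1 \<Lambda>\<^sub>1" and "has_distortion_matrix E\<^sub>2 \<Lambda>\<^sub>2"
    and "\<Lambda>\<^sub>1 = \<alpha>\<^sub>1 *\<^sub>R R\<^sub>1" and "\<Lambda>\<^sub>2 = \<alpha>\<^sub>2 *\<^sub>R R\<^sub>2"
    and "rotation_matrix R\<^sub>1" and "rotation_matrix R\<^sub>2"
  shows "entropic_channel_divergence E\<^sub>1 E\<^sub>2 =
    sqrt (bloch_entropy (r_opt \<alpha>\<^sub>1 R\<^sub>1 \<alpha>\<^sub>2 R\<^sub>2)
      - (bloch_entropy (\<alpha>\<^sub>1\<^sup>2) + bloch_entropy (\<alpha>\<^sub>2\<^sup>2)) / 2)"
proof -
  note R = assms(9,10)
  note dist = assms(5,6)[unfolded assms(7,8)]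
  let ?avg = "\<lambda>r. (1/2) *\<^sub>R ((\<alpha>\<^sub>1 *\<^sub>R R\<^sub>1) *v r + (\<alpha>\<^sub>2 *\<^sub>R R\<^sub>2) *v r)"
  define m where "m = sqrt (r_opt \<alpha>\<^sub>1 R\<^sub>1 \<alpha>\<^sub>2 R\<^sub>2)"
  define V where "V = radial_entropy m - (radial_entropy \<bar>\<alpha>\<^sub>1\<bar> + radial_entropy \<bar>\<alpha>\<^sub>2\<bar>) / 2"
  have \<alpha>: "\<bar>\<alpha>\<^sub>1\<bar> \<le> 1" "\<bar>\<alpha>\<^sub>2\<bar> \<le> 1"
    by (rule quantum_channel_scale_le_1[OF assms(1) dist(1) R(1)]
        quantum_channel_scale_le_1[OF assms(3) dist(2) R(2)])+
  have norms: "norm ((\<alpha>\<^sub>1 *\<^sub>R R\<^sub>1) *v r) = norm r * \<bar>\<alpha>\<^sub>1\<bar>" "norm ((\<alpha>\<^sub>2 *\<^sub>R R\<^sub>2) *v r) = norm r * \<bar>\<alpha>\<^sub>2\<bar>" for r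
    by (simp_all add: rotation_matrix_norm R mult.commute flip: scaleR_matrix_vector_assoc)
  have avg_le: "norm (?avg r) \<le> norm r * ((\<bar>\<alpha>\<^sub>1\<bar> + \<bar>\<alpha>\<^sub>2\<bar>) / 2)" for r
    using norm_triangle_ineq[of "(\<alpha>\<^sub>1 *\<^sub>R R\<^sub>1) *v r" "(\<alpha>\<^sub>2 *\<^sub>R R\<^sub>2) *v r"]
    unfolding norms norm_scaleR by (simp add: distrib_left)
  have QJSD: "QJSD (E\<^sub>1 (bloch_state r)) (E\<^sub>2 (bloch_state r)) = radial_entropy (norm (?avg r))
      - (radial_entropy (norm r * \<bar>\<alpha>\<^sub>1\<bar>) + radial_entropy (norm r * \<bar>\<alpha>\<^sub>2\<bar>)) / 2"
    if "norm r \<le> 1" for r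
    using dist that unfolding has_distortion_matrix_def by (simp only: QJSD_bloch_state norms)
  \<comment> \<open>The optimal pure input \<open>u\<close> serves three times: it identifies
    \<open>m\<close> as a length, bounds \<open>m\<close> through the triangle inequality, and
    attains the supremum.\<close>
  from norm_average_rotations_lower(2)[OF R, of \<alpha>\<^sub>1 \<alpha>\<^sub>2]
  obtain u where u: "norm u = 1" "(norm (?avg u))\<^sup>2 = r_opt \<alpha>\<^sub>1 R\<^sub>1 \<alpha>\<^sub>2 R\<^sub>2"
    by (elim exE conjE)
  have m_u: "m = norm (?avg u)" by (simp only: m_def u(2)[symmetric] real_sqrt_abs abs_norm_cancel)
  have m: "0 \<le> m" "m \<le> (\<bar>\<alpha>\<^sub>1\<bar> + \<bar>\<alpha>\<^sub>2\<bar>) / 2"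
    using avg_le[of u] u(1) unfolding m_u by (simp_all only: norm_ge_zero mult_1)
  have upper: "QJSD (E\<^sub>1 (bloch_state r)) (E\<^sub>2 (bloch_state r)) \<le> V" if r: "norm r \<le> 1" for r
  proof -
    have "(norm r * m)\<^sup>2 = r_opt \<alpha>\<^sub>1 R\<^sub>1 \<alpha>\<^sub>2 R\<^sub>2 * (norm r)\<^sup>2"
      unfolding m_u power_mult_distrib u(2) by (rule mult.commute)
    also have "\<dots> \<le> (norm (?avg r))\<^sup>2"
      by (rule norm_average_rotations_lower(1)[OF R])
    finally have ge: "norm r * m \<le> norm (?avg r)"
      by (rule power2_le_imp_le) simp
    \<comment> \<open>Antitonicity of the entropy holds for lengths up to 1, so the averaged output
      must lie in the Bloch ball.\<close>
    have "norm r * ((\<bar>\<alpha>\<^sub>1\<bar> + \<bar>\<alpha>\<^sub>2\<bar>) / 2) \<le> 1"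
      using r \<alpha> by (intro mult_le_one) auto
    then have "norm (?avg r) \<le> 1" by (rule order_trans[OF avg_le])
    then have "radial_entropy (norm (?avg r)) \<le> radial_entropy (norm r * m)"
      using ge m(1) by (intro radial_entropy_antimono) auto
    \<comment> \<open>The passage from radius \<open>norm r\<close>, in the role of s, to pure
      inputs.\<close>
    moreover have "radial_entropy (norm r * m)
        - (radial_entropy (norm r * \<bar>\<alpha>\<^sub>1\<bar>) + radial_entropy (norm r * \<bar>\<alpha>\<^sub>2\<bar>)) / 2 \<le> V"
      unfolding V_def using r \<alpha> m by (intro radial_entropy_jensen_gap_mono) auto
    ultimately show ?thesis unfolding QJSD[OF r] by linarith
  qed
  have attained: "QJSD (E\<^sub>1 (bloch_state u)) (E\<^sub>2 (bloch_state u)) = V"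
    using QJSD[of u] u(1) by (simp only: V_def m_u order_refl mult_1)
  have "entropic_channel_divergence E\<^sub>1 E\<^sub>2 = sqrt V"
    unfolding entropic_channel_divergence_def
  proof (rule cSup_eq_maximum)
    show "sqrt V \<in> (\<lambda>\<rho>. sqrt (QJSD (E\<^sub>1 \<rho>) (E\<^sub>2 \<rho>))) ` {\<rho>. density_matrix \<rho>}"
      using u(1) by (intro image_eqI[of _ _ "bloch_state u"]) (simp_all add: attained density_bloch_state_iff)
    fix y assume "y \<in> (\<lambda>\<rho>. sqrt (QJSD (E\<^sub>1 \<rho>) (E\<^sub>2 \<rho>))) ` {\<rho>. density_matrix \<rho>}"
    then show "y \<le> sqrt V"
      by (auto elim!: density_matrix_bloch intro!: upper)
  qed
  then show ?thesis
    by (simp add: V_def m_def bloch_entropy_radial)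
qed

end
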